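(* Let $n\ge 1$, let $\bm Y,\bm Z\in\mathbb{R}^n$, $\sigma>0$ and $\bm X=\bm Y+\sigma\bm Z$. Let $p\ge 1$ and let $1\le q\le\infty$ be its conjugate exponent ($1/p+1/q=1$). For any proxy $\bm\psi\in\mathbb{R}^n$, any weight $\bm w\in[0,\infty)^n$ and any $r\in\{1,2\}$ such that $\bm\psi\odot\bm w\neq\bm 0$, we have $$|\Sigma_r-\sigma|\le 2^{2-r}\,\frac{\big\|\bm w\odot|\bm\psi|^{r-1}\big\|_q}{\langle\bm w,|\bm\psi|^r\rangle}\,\|\bm Y\|_p+2^{2-r}\,\sigma\left(\frac{\langle\bm w,|\bm Z^{\uparrow}-\bm\psi|^r\rangle}{\langle\bm w,|\bm\psi|^r\rangle}\right)^{1/r}.$$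
   Context: For $\bm x\in\mathbb{R}^n$, $\bm x^{\uparrow}$ denotes the non-decreasing rearrangement of $\bm x$. Functions of vectors are applied coordinatewise, e.g. $|\bm x|^r=(|x_k|^r)_{k}$, with $|\bm x|^0=(1,\dots,1)$; $\bm a\odot\bm b=(a_kb_k)_k$; $\langle\cdot,\cdot\rangle$ is the Euclidean inner product and $\|\cdot\|_p$ the usual $\ell^p$-norm on $\mathbb{R}^n$. The weighted $L^r$-loss is $$\ell^r_{\bm w}(s)=\sum_{k=1}^n w_k\,|X_k^{\uparrow}-s\psi_k|^r,\qquad s\in\mathbb{R},$$ and $\Sigma_r\in\arg\min_{s\in\mathbb{R}}\ell^r_{\bm w}(s)$ is a minimizer of this loss (for $r=2$, $\Sigma_2=\langle\bm w,\bm\psi\odot\bm X^{\uparrow}\rangle/\langle\bm w,\bm\psi^2\rangle$). *)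

theory Defs
  imports "HOL-Analysis.Analysis"
begin

text \<open>
  Vectors of dimension \<open>n\<close> are elements of \<open>real ^ 'n\<close>, where the index type is finite and linearly
  ordered and hence order-isomorphic to \<open>{1..n}\<close> with \<open>n = CARD('n) \<ge> 1\<close>. Multiplication \<open>(*)\<close> on
  \<open>real ^ 'n\<close> is the coordinatewise product.
\<close>

text \<open>The number \<open>card {..<k}\<close> is the (zero-based) position of \<open>k\<close> in the index type.\<close>

definition rearr :: "real ^ 'n::{finite,linorder} \<Rightarrow> real ^ 'n::{finite,linorder}" where
  "rearr x = (\<chi> k. sort (map (($) x) (sorted_list_of_set UNIV)) ! card {..<k})"

lemma card_lessThan_less:
  fixes i j :: "'n::{finite,linorder}"
  assumes "i < j"
  shows "card {..<i} < card {..<j}"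
  using assms by (intro psubset_card_mono) auto

lemma rearr_mono:
  fixes x :: "real ^ 'n::{finite,linorder}"
  shows "mono (($) (rearr x))"
proof (rule monoI)
  fix i j :: 'n
  assume "i \<le> j"
  then have "card {..<i} \<le> card {..<j}"
    by (intro card_mono) auto
  moreover have "card {..<j} < CARD('n)"
    by (intro psubset_card_mono) auto
  ultimately show "rearr x $ i \<le> rearr x $ j"
    by (simp add: rearr_def sorted_nth_mono)
qed

lemma rearr_permutes:
  fixes x :: "real ^ 'n::{finite,linorder}"
  shows "\<exists>\<pi>. bij \<pi> \<and> (\<forall>k. rearr x $ k = x $ \<pi> k)"
proof -
  define L :: "'n list" where "L = sorted_list_of_set UNIV"
  define rank :: "'n \<Rightarrow> nat" where "rank k = card {..<k}" for k
  have L: "distinct L" "set L = UNIV" "length L = CARD('n)"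
    by (simp_all add: L_def)
  define M where "M = sort_key (($) x) L"
  have M: "distinct M" "set M = UNIV" "length M = CARD('n)"
    using L by (simp_all add: M_def)
  have "sort (map (($) x) L) = map (($) x) M"
    by (rule properties_for_sort) (simp_all add: M_def)
  moreover have rank_less: "rank k < CARD('n)" for k
    unfolding rank_def by (intro psubset_card_mono) auto
  ultimately have eq: "rearr x $ k = x $ (M ! rank k)" for k
    using M(3) by (simp add: rearr_def L_def rank_def)
  have "inj rank"
    unfolding rank_def by (rule linorder_injI) (use card_lessThan_less in force)
  then have "inj (\<lambda>k. M ! rank k)"
    using M rank_less by (auto simp: inj_def nth_eq_iff_index_eq)
  then have "bij (\<lambda>k. M ! rank k)"
    by (simp add: bij_def finite_UNIV_inj_surj)
  with eq show ?thesis by blast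
qed

definition abs_pow :: "real ^ 'n \<Rightarrow> nat \<Rightarrow> real ^ 'n" where
  "abs_pow x r = (\<chi> k. \<bar>x $ k\<bar> ^ r)"

definition lp_norm :: "ennreal \<Rightarrow> real ^ 'n \<Rightarrow> real" where
  "lp_norm p x =
     (if p = top then MAX k. \<bar>x $ k\<bar>
      else (\<Sum>k\<in>UNIV. \<bar>x $ k\<bar> powr enn2real p) powr (1 / enn2real p))"

definition weighted_loss ::
    "nat \<Rightarrow> real ^ 'n::{finite,linorder} \<Rightarrow> real ^ 'n::{finite,linorder} \<Rightarrow>
      real ^ 'n::{finite,linorder} \<Rightarrow> real \<Rightarrow> real" where
  "weighted_loss r w \<psi> X s = (\<Sum>k\<in>UNIV. w $ k * \<bar>rearr X $ k - s * \<psi> $ k\<bar> ^ r)"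

end

theory Submission imports Defs begin

text \<open>
  Sorting is a contraction in every \<open>\<ell>\<^sup>p\<close>-norm, so \<open>X\<^sup>\<up> - \<sigma> \<psi>\<close> is the sum of \<open>D = X\<^sup>\<up> - \<sigma> Z\<^sup>\<up>\<close>, with
  \<open>\<parallel>D\<parallel>\<^sub>p \<le> \<parallel>Y\<parallel>\<^sub>p\<close>, and \<open>\<sigma> (Z\<^sup>\<up> - \<psi>)\<close>. For \<open>r = 1\<close>, the quantity \<open>\<langle>w, \<bar>S \<psi> - \<sigma> \<psi>\<bar>\<rangle>\<close> is at most the
  loss at \<open>S\<close> plus the loss at \<open>\<sigma>\<close>, hence at most twice the latter; for \<open>r = 2\<close>, the minimizer is
  linear in \<open>X\<^sup>\<up>\<close>. The two summands are then bounded by Hoelder's inequality and (for \<open>r = 2\<close>) the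
  Cauchy-Schwarz inequality. The contraction follows from exchanging inverted pairs; for \<open>p = \<infinity>\<close>
  it is applied to the convex function \<open>max 0 (\<bar>x\<bar> - M)\<close> with \<open>M\<close> the sup-norm before sorting.
\<close>

section \<open>Rearrangement inequality for convex functions\<close>

text \<open>The equal sums put \<open>s\<close> and \<open>t\<close> between \<open>u\<close> and
  \<open>v\<close>, as convex combinations with complementary weights; adding the two convexity
  inequalities makes the weights cancel.\<close>

lemma convex_on_exchange:
  fixes \<phi> :: "real \<Rightarrow> real"
  assumes "convex_on UNIV \<phi>" "u \<le> s" "u \<le> t" "s + t = u + v"
  shows "\<phi> s + \<phi> t \<le> \<phi> u + \<phi> v"
proof (cases "u = v")
  case True
  with assms have "s = u" "t = u" by linarith+
  with True show ?thesis by simp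
next
  case False
  with assms have "u < v" by linarith
  define a where "a = (s - u) / (v - u)"
  have a: "0 \<le> a" "a \<le> 1"
    using assms \<open>u < v\<close> by (auto simp: a_def field_simps)
  have "a * (v - u) = s - u"
    using \<open>u < v\<close> by (simp add: a_def)
  then have s: "s = (1 - a) * u + a * v" and t: "t = (1 - (1 - a)) * u + (1 - a) * v"
    using assms(4) by (auto simp: algebra_simps)
  have "\<phi> s \<le> (1 - a) * \<phi> u + a * \<phi> v"
    using convex_onD[OF assms(1), of a u v] a by (simp add: s)
  moreover have "\<phi> t \<le> (1 - (1 - a)) * \<phi> u + (1 - a) * \<phi> v"
    using convex_onD[OF assms(1), of "1 - a" u v] a unfolding t real_scaleR_def by simp
  ultimately show ?thesis by (simp add: algebra_simps)
qed

text \<open>A permutation preserves the number of indices with value at most \<open>c\<close>, and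
  these counts determine a monotone function, since its sublevel sets are initial segments.\<close>

lemma mono_permutation_unique:
  fixes f g :: "'n::{finite,linorder} \<Rightarrow> real"
  assumes "mono f" "mono g" "bij \<tau>" "\<And>k. g k = f (\<tau> k)"
  shows "f = g"
proof -
  have card_eq: "card {i. g i \<le> c} = card {i. f i \<le> c}" for c
  proof -
    have "{i. g i \<le> c} = \<tau> -` {i. f i \<le> c}"
      using assms(4) by auto
    then show ?thesis
      using card_vimage_inj[of \<tau> "{i. f i \<le> c}"] assms(3) by (simp add: bij_def)
  qed
  \<comment> \<open>At the threshold \<open>f' k\<close>, the sublevel set of \<open>g'\<close> lies
    strictly before \<open>k\<close>, while that of \<open>f'\<close> also contains
    \<open>k\<close>. Keeping \<open>f'\<close> and \<open>g'\<close> arbitrary covers both signs of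
    a difference at \<open>k\<close>.\<close>
  have less: False
    if "mono f'" "mono g'" "f' k < g' k" "card {i. g' i \<le> f' k} = card {i. f' i \<le> f' k}"
    for f' g' :: "'n \<Rightarrow> real" and k
  proof -
    have "g' i \<le> f' k \<Longrightarrow> i < k" for i
      using monoD[OF that(2), of k i] that(3) by (meson leD le_less_trans linorder_le_less_linear)
    then have "{i. g' i \<le> f' k} \<subset> {i. f' i \<le> f' k}"
      using monoD[OF that(1), of _ k] by fastforce
    then show False
      using psubset_card_mono[of "{i. f' i \<le> f' k}" "{i. g' i \<le> f' k}"] that(4) by simp
  qed
  show ?thesis
  proof
    fix k
    show "f k = g k"
      using less[of f g k] less[of g f k] card_eq assms(1,2) by (metis linorder_neq_iff)
  qed
qed

text \<open>
  Among all reorderings of \<open>g\<close> that do not increase the sum, one maximizing the pairing with the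
  positions must be monotone, as exchanging an inverted pair increases the pairing strictly.
\<close>

lemma sum_convex_rearrangement_le:
  fixes f g :: "'n::{finite,linorder} \<Rightarrow> real" and \<phi> :: "real \<Rightarrow> real"
  assumes "convex_on UNIV \<phi>" "mono f" "mono g" "bij \<tau>"
  shows "(\<Sum>k\<in>UNIV. \<phi> (f k - g k)) \<le> (\<Sum>k\<in>UNIV. \<phi> (f k - g (\<tau> k)))"
proof -
  define c where "c \<rho> = (\<Sum>k\<in>UNIV. \<phi> (f k - g (\<rho> k)))" for \<rho> :: "'n \<Rightarrow> 'n"
  define d where "d \<rho> = (\<Sum>k\<in>UNIV. real (card {..<k}) * g (\<rho> k))" for \<rho> :: "'n \<Rightarrow> 'n"
  define A where "A = {\<rho>. bij \<rho> \<and> c \<rho> \<le> c \<tau>}"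
  have "A \<noteq> {}"
    using assms(4) by (auto simp: A_def)
  then obtain \<rho> where "\<rho> \<in> A" and "Max (d ` A) = d \<rho>"
    using obtains_MAX[of A d] by auto
  then have max: "d \<rho>' \<le> d \<rho>" if "\<rho>' \<in> A" for \<rho>'
    using that Max_ge[of "d ` A" "d \<rho>'"] by simp
  have \<rho>: "bij \<rho>" "c \<rho> \<le> c \<tau>"
    using \<open>\<rho> \<in> A\<close> by (auto simp: A_def)
  have "mono (\<lambda>k. g (\<rho> k))"
  proof (rule ccontr)
    assume "\<not> mono (\<lambda>k. g (\<rho> k))"
    then obtain i j where "i \<le> j" and inv: "g (\<rho> j) < g (\<rho> i)"
      by (auto simp: mono_def not_le)
    then have "i < j" by (metis less_irrefl order_le_less)
    define \<rho>' where "\<rho>' = \<rho> \<circ> Transposition.transpose i j"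
    have split: "(\<Sum>k\<in>UNIV. h k) = h i + h j + (\<Sum>k\<in>UNIV - {i, j}. h k)" for h :: "'n \<Rightarrow> real"
      using \<open>i < j\<close> by (simp add: sum.remove[of UNIV i] sum.remove[of "UNIV - {i}" j] insert_commute
          Diff_insert2[symmetric])
    have rest: "\<rho>' k = \<rho> k" if "k \<noteq> i" "k \<noteq> j" for k
      using that by (simp add: \<rho>'_def)
    have swap: "\<rho>' i = \<rho> j" "\<rho>' j = \<rho> i"
      by (simp_all add: \<rho>'_def)
    \<comment> \<open>The swap keeps the sum of the two differences, and
      \<open>f i - g (\<rho> i)\<close> is the least of all four because
      \<open>f i \<le> f j\<close> and the pair is inverted.\<close>
    have "\<phi> (f i - g (\<rho> j)) + \<phi> (f j - g (\<rho> i)) \<le> \<phi> (f i - g (\<rho> i)) + \<phi> (f j - g (\<rho> j))"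
      using inv monoD[OF assms(2) \<open>i \<le> j\<close>] by (intro convex_on_exchange assms(1)) auto
    then have "c \<rho>' \<le> c \<rho>"
      unfolding c_def split by (simp add: swap rest cong: sum.cong_simp)
    moreover have "bij \<rho>'"
      unfolding \<rho>'_def using \<rho>(1) by (intro bij_comp) auto
    ultimately have "\<rho>' \<in> A"
      using \<rho>(2) by (simp add: A_def)
    moreover have "d \<rho> < d \<rho>'"
    proof -
      \<comment> \<open>This product is exactly \<open>d \<rho>' - d \<rho>\<close>.\<close>
      have "0 < (real (card {..<j}) - real (card {..<i})) * (g (\<rho> i) - g (\<rho> j))"
        using card_lessThan_less[OF \<open>i < j\<close>] inv by (intro mult_pos_pos) auto
      then show ?thesis
        unfolding d_def split by (simp add: swap rest algebra_simps cong: sum.cong_simp)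
    qed
    ultimately show False
      using max by force
  qed
  then have "g = (\<lambda>k. g (\<rho> k))"
    using mono_permutation_unique[OF assms(3) _ \<rho>(1)] by simp
  then show ?thesis
    using \<rho>(2) by (metis (no_types, lifting) c_def sum.cong)
qed

text \<open>Reindexing by the permutation that sorts \<open>x\<close> turns the right-hand side into
  sorted \<open>x\<close> paired with a reordering \<open>\<tau>\<close> of sorted
  \<open>y\<close>.\<close>

lemma sum_convex_rearr_le:
  fixes x y :: "real ^ 'n::{finite,linorder}"
  assumes "convex_on UNIV \<phi>"
  shows "(\<Sum>k\<in>UNIV. \<phi> (rearr x $ k - rearr y $ k)) \<le> (\<Sum>k\<in>UNIV. \<phi> (x $ k - y $ k))"
proof -
  obtain \<alpha> \<beta> where \<alpha>: "bij \<alpha>" "\<And>k. rearr x $ k = x $ \<alpha> k"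
    and \<beta>: "bij \<beta>" "\<And>k. rearr y $ k = y $ \<beta> k"
    using rearr_permutes[of x] rearr_permutes[of y] by blast
  define \<tau> where "\<tau> = inv \<beta> \<circ> \<alpha>"
  have "bij \<tau>"
    unfolding \<tau>_def using \<alpha>(1) \<beta>(1) by (intro bij_comp bij_imp_bij_inv)
  have *: "rearr y $ \<tau> k = y $ \<alpha> k" for k
    using \<beta> by (simp add: \<tau>_def bij_is_surj surj_f_inv_f)
  have "(\<Sum>k\<in>UNIV. \<phi> (rearr x $ k - rearr y $ k)) \<le> (\<Sum>k\<in>UNIV. \<phi> (rearr x $ k - rearr y $ \<tau> k))"
    by (intro sum_convex_rearrangement_le assms rearr_mono \<open>bij \<tau>\<close>)
  also have "\<dots> = (\<Sum>k\<in>UNIV. \<phi> (x $ \<alpha> k - y $ \<alpha> k))"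
    unfolding * \<alpha>(2) ..
  also have "\<dots> = (\<Sum>k\<in>UNIV. \<phi> (x $ k - y $ k))"
    by (rule sum.reindex_bij_betw) (rule \<alpha>(1))
  finally show ?thesis .
qed

text \<open>Both sides are monotone and permutations of each other, hence equal by
  \<open>mono_permutation_unique\<close>.\<close>

lemma rearr_scaleR:
  fixes x :: "real ^ 'n::{finite,linorder}"
  assumes "0 \<le> c"
  shows "rearr (c *\<^sub>R x) = c *\<^sub>R rearr x"
proof -
  obtain \<alpha> \<beta> where \<alpha>: "bij \<alpha>" "\<And>k. rearr x $ k = x $ \<alpha> k"
    and \<beta>: "bij \<beta>" "\<And>k. rearr (c *\<^sub>R x) $ k = (c *\<^sub>R x) $ \<beta> k"
    using rearr_permutes[of x] rearr_permutes[of "c *\<^sub>R x"] by blast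
  have "($) (c *\<^sub>R rearr x) = ($) (rearr (c *\<^sub>R x))"
  proof (rule mono_permutation_unique[where \<tau> = "inv \<alpha> \<circ> \<beta>"])
    show "mono (($) (c *\<^sub>R rearr x))"
      using assms monoD[OF rearr_mono[of x]] by (auto intro!: monoI mult_left_mono)
    show "bij (inv \<alpha> \<circ> \<beta>)"
      using \<alpha>(1) \<beta>(1) by (intro bij_comp bij_imp_bij_inv)
    show "rearr (c *\<^sub>R x) $ k = (c *\<^sub>R rearr x) $ (inv \<alpha> \<circ> \<beta>) k" for k
      using \<alpha> \<beta>(2) by (simp add: bij_is_surj surj_f_inv_f)
  qed (rule rearr_mono)
  then show ?thesis by (simp add: vec_eq_iff)
qed


section \<open>The norms\<close>

lemma convex_on_abs_powr:
  assumes "1 \<le> p"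
  shows "convex_on UNIV (\<lambda>x::real. \<bar>x\<bar> powr p)"
proof (rule convex_onI)
  fix t x y :: real
  assume t: "0 < t" "t < 1"
  have nonneg: "((1 - t) * a + t * b) powr p \<le> (1 - t) * a powr p + t * b powr p"
    if "0 \<le> a" "0 \<le> b" for a b
  proof -
    \<comment> \<open>If \<open>a\<close> or \<open>b\<close> is zero, the claim reduces to this
      bound with \<open>s\<close> the weight of the other one; positive arguments are left to
      \<open>powr_convex\<close>.\<close>
    have le: "s powr p \<le> s" if "0 < s" "s < 1" for s :: real
      using powr_mono'[of 1 p s] that assms by simp
    consider "a = 0" | "b = 0" | "0 < a" "0 < b"
      using \<open>0 \<le> a\<close> \<open>0 \<le> b\<close> by linarith
    then show ?thesis
    proof cases
      case 1
      then show ?thesis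
        using t that le[of t] assms by (simp add: powr_mult mult_right_mono)
    next
      case 2
      then show ?thesis
        using t that le[of "1 - t"] assms by (simp add: powr_mult mult_right_mono)
    next
      case 3
      then show ?thesis
        using convex_onD[OF powr_convex[OF assms], of t a b] t by simp
    qed
  qed
  have "\<bar>(1 - t) *\<^sub>R x + t *\<^sub>R y\<bar> \<le> (1 - t) * \<bar>x\<bar> + t * \<bar>y\<bar>"
    using t abs_triangle_ineq[of "(1 - t) * x" "t * y"] by (simp add: abs_mult)
  then have "\<bar>(1 - t) *\<^sub>R x + t *\<^sub>R y\<bar> powr p \<le> ((1 - t) * \<bar>x\<bar> + t * \<bar>y\<bar>) powr p"
    using assms by (intro powr_mono2) auto
  also have "\<dots> \<le> (1 - t) * \<bar>x\<bar> powr p + t * \<bar>y\<bar> powr p"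
    by (rule nonneg) auto
  finally show "\<bar>(1 - t) *\<^sub>R x + t *\<^sub>R y\<bar> powr p \<le> (1 - t) * \<bar>x\<bar> powr p + t * \<bar>y\<bar> powr p" .
qed simp

lemma convex_on_excess:
  "convex_on UNIV (\<lambda>x::real. max 0 (\<bar>x\<bar> - M))"
proof (rule convex_onI)
  fix t x y :: real
  assume t: "0 < t" "t < 1"
  have "\<bar>(1 - t) *\<^sub>R x + t *\<^sub>R y\<bar> \<le> (1 - t) * \<bar>x\<bar> + t * \<bar>y\<bar>"
    using t abs_triangle_ineq[of "(1 - t) * x" "t * y"] by (simp add: abs_mult)
  then have "\<bar>(1 - t) *\<^sub>R x + t *\<^sub>R y\<bar> - M \<le> (1 - t) * (\<bar>x\<bar> - M) + t * (\<bar>y\<bar> - M)"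
    by (simp add: algebra_simps)
  also have "\<dots> \<le> (1 - t) * max 0 (\<bar>x\<bar> - M) + t * max 0 (\<bar>y\<bar> - M)"
    using t by (intro add_mono mult_left_mono) auto
  finally show "max 0 (\<bar>(1 - t) *\<^sub>R x + t *\<^sub>R y\<bar> - M)
      \<le> (1 - t) * max 0 (\<bar>x\<bar> - M) + t * max 0 (\<bar>y\<bar> - M)"
    using t by simp
qed simp

lemma lp_norm_nonneg: "0 \<le> lp_norm p x"
proof -
  have "0 \<le> (MAX k. \<bar>x $ k\<bar>)"
    by (rule order_trans[OF abs_ge_zero Max_ge[of _ "\<bar>x $ undefined\<bar>"]]) auto
  then show ?thesis by (simp add: lp_norm_def)
qed

lemma abs_le_lp_norm_top: "\<bar>x $ k\<bar> \<le> lp_norm top x"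
  by (simp add: lp_norm_def)

lemma lp_norm_one: "lp_norm 1 x = (\<Sum>k\<in>UNIV. \<bar>x $ k\<bar>)"
  by (simp add: lp_norm_def sum_nonneg)

text \<open>For finite \<open>p\<close> the sums of \<open>p\<close>-th powers are compared. The
  sup-norm is not such a sum, but a bound by \<open>M\<close> is equivalent to the vanishing of the
  sum of excesses over \<open>M\<close>.\<close>

lemma lp_norm_rearr_diff_le:
  fixes x y :: "real ^ 'n::{finite,linorder}"
  assumes "1 \<le> p"
  shows "lp_norm p (rearr x - rearr y) \<le> lp_norm p (x - y)"
proof (cases "p = top")
  case True
  define M where "M = lp_norm top (x - y)"
  have "(\<Sum>k\<in>UNIV. max 0 (\<bar>rearr x $ k - rearr y $ k\<bar> - M))
      \<le> (\<Sum>k\<in>UNIV. max 0 (\<bar>x $ k - y $ k\<bar> - M))"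
    by (rule sum_convex_rearr_le[OF convex_on_excess])
  also have "\<dots> = 0"
    using abs_le_lp_norm_top[of "x - y"] by (intro sum.neutral) (simp add: M_def)
  finally have "(\<Sum>k\<in>UNIV. max 0 (\<bar>rearr x $ k - rearr y $ k\<bar> - M)) = 0"
    by (intro antisym sum_nonneg) auto
  then have "\<forall>k\<in>UNIV. max 0 (\<bar>rearr x $ k - rearr y $ k\<bar> - M) = 0"
    by (subst (asm) sum_nonneg_eq_0_iff) auto
  then have "\<bar>rearr x $ k - rearr y $ k\<bar> \<le> M" for k
    by (metis UNIV_I diff_le_0_iff_le max.cobounded2)
  then show ?thesis
    unfolding True M_def[symmetric] by (simp add: lp_norm_def)
next
  case False
  with assms have P: "1 \<le> enn2real p"
    by (cases p rule: ennreal_cases) auto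
  show ?thesis
    using sum_convex_rearr_le[OF convex_on_abs_powr[OF P], of x y] P False
    by (simp add: lp_norm_def powr_mono2 sum_nonneg)
qed

section \<open>Hoelder's inequality, including the endpoint exponents\<close>

lemma sum_mult_le_Holder:
  fixes a b :: "'i \<Rightarrow> real" and p q :: real
  assumes "1 < p" "1 < q" "1 / p + 1 / q = 1" "finite I"
    and "\<And>i. i \<in> I \<Longrightarrow> 0 \<le> a i" "\<And>i. i \<in> I \<Longrightarrow> 0 \<le> b i"
  shows "(\<Sum>i\<in>I. a i * b i)
    \<le> (\<Sum>i\<in>I. a i powr p) powr (1 / p) * (\<Sum>i\<in>I. b i powr q) powr (1 / q)"
proof -
  define A where "A = (\<Sum>i\<in>I. a i powr p)"
  define B where "B = (\<Sum>i\<in>I. b i powr q)"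
  have "0 \<le> A" "0 \<le> B"
    by (auto simp: A_def B_def sum_nonneg)
  then consider "A = 0" | "B = 0" | "0 < A" "0 < B"
    by linarith
  then have "(\<Sum>i\<in>I. a i * b i) \<le> A powr (1 / p) * B powr (1 / q)"
  proof cases
    case 1
    then have "\<forall>i\<in>I. a i = 0"
      using assms(4) by (simp add: A_def sum_nonneg_eq_0_iff)
    then show ?thesis by simp
  next
    case 2
    then have "\<forall>i\<in>I. b i = 0"
      using assms(4) by (simp add: B_def sum_nonneg_eq_0_iff)
    then show ?thesis by simp
  next
    case 3
    define \<alpha> where "\<alpha> = A powr (1 / p)"
    define \<beta> where "\<beta> = B powr (1 / q)"
    have pos: "0 < \<alpha>" "0 < \<beta>"
      using 3 by (auto simp: \<alpha>_def \<beta>_def)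
    have pow: "\<alpha> powr p = A" "\<beta> powr q = B"
      using 3 assms(1,2) by (auto simp: \<alpha>_def \<beta>_def powr_powr)
    \<comment> \<open>With both factors normalized to unit norm, Young's inequality applies termwise
      and the bounds add up to \<open>1 / p + 1 / q = 1\<close>.\<close>
    have "(\<Sum>i\<in>I. (a i / \<alpha>) * (b i / \<beta>)) \<le> (\<Sum>i\<in>I. a i powr p / A / p + b i powr q / B / q)"
    proof (rule sum_mono)
      fix i assume "i \<in> I"
      then show "(a i / \<alpha>) * (b i / \<beta>) \<le> a i powr p / A / p + b i powr q / B / q"
        using Youngs_inequality[OF assms(1-3), of "a i / \<alpha>" "b i / \<beta>"] assms(5,6) pos
        by (simp add: powr_divide pow)
    qed
    also have "\<dots> = (\<Sum>i\<in>I. a i powr p) / A / p + (\<Sum>i\<in>I. b i powr q) / B / q"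
      by (simp add: sum.distrib sum_divide_distrib)
    also have "\<dots> = 1"
      using 3 assms(3) by (simp flip: A_def B_def)
    finally have "(\<Sum>i\<in>I. a i * b i) / (\<alpha> * \<beta>) \<le> 1"
      by (simp add: sum_divide_distrib)
    then show ?thesis
      using pos by (simp add: divide_le_eq flip: \<alpha>_def \<beta>_def)
  qed
  then show ?thesis by (simp only: A_def B_def)
qed

lemma sum_abs_mult_le_lp_norm_top:
  "(\<Sum>k\<in>UNIV. \<bar>u $ k\<bar> * \<bar>v $ k\<bar>) \<le> lp_norm 1 u * lp_norm top v"
  unfolding lp_norm_one sum_distrib_right
  by (intro sum_mono mult_left_mono abs_le_lp_norm_top) auto

lemma sum_abs_mult_le_lp_norm:
  assumes "1 \<le> p" "1 \<le> q" "1 / p + 1 / q = 1"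
  shows "(\<Sum>k\<in>UNIV. \<bar>u $ k\<bar> * \<bar>v $ k\<bar>) \<le> lp_norm q u * lp_norm p v"
proof -
  \<comment> \<open>As \<open>1 / top = 0\<close> in \<open>ennreal\<close>, this makes the
    conjugate of \<open>top\<close> equal to \<open>1\<close>.\<close>
  have one: "s = 1" if "1 \<le> s" "1 / s = 1" for s :: ennreal
    using that divide_ennreal[of 1] by (cases s rule: ennreal_cases) (auto simp: divide_eq_eq)
  consider "p = top" | "q = top" | "p \<noteq> top" "q \<noteq> top"
    by blast
  then show ?thesis
  proof cases
    case 1
    then have "q = 1"
      using assms one by simp
    with 1 show ?thesis
      by (simp add: sum_abs_mult_le_lp_norm_top)
  next
    case 2
    then have "p = 1"
      using assms one by simp
    with 2 show ?thesis
      using sum_abs_mult_le_lp_norm_top[of v u] by (simp add: mult.commute)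
  next
    case 3
    define P where "P = enn2real p"
    define Q where "Q = enn2real q"
    have pq: "p = ennreal P" "q = ennreal Q" "1 \<le> P" "1 \<le> Q"
      using 3 assms(1,2) unfolding P_def Q_def
      by (cases p rule: ennreal_cases; cases q rule: ennreal_cases; simp)+
    have "ennreal (1 / P + 1 / Q) = 1 / p + 1 / q"
      using pq divide_ennreal[of 1] by (simp add: ennreal_plus)
    then have PQ: "1 / P + 1 / Q = 1"
      using assms(3) pq(3,4) by (simp only: ennreal_eq_1)
    then have "1 < P" "1 < Q"
      using pq(3,4) by (auto simp: order_le_less)
    then show ?thesis
      using sum_mult_le_Holder[of Q P UNIV "\<lambda>k. \<bar>u $ k\<bar>" "\<lambda>k. \<bar>v $ k\<bar>"] PQ 3
      by (simp add: lp_norm_def add.commute flip: P_def Q_def)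
  qed
qed

section \<open>Minimizers of the loss\<close>

text \<open>Comparing \<open>s\<close> with the vertex \<open>b / c\<close> and multiplying by
  \<open>c\<close> completes the square.\<close>

lemma quadratic_arg_min_eq:
  fixes a b c s :: real
  assumes "0 < c" "\<And>t. a - 2 * b * s + c * s\<^sup>2 \<le> a - 2 * b * t + c * t\<^sup>2"
  shows "c * s = b"
proof -
  have "c * (a - 2 * b * s + c * s\<^sup>2) \<le> c * (a - 2 * b * (b / c) + c * (b / c)\<^sup>2)"
    by (intro mult_left_mono assms(2)) (use assms(1) in simp)
  also have "\<dots> = c * a - b\<^sup>2"
    using assms(1) by (simp add: power2_eq_square field_simps)
  finally have "(c * s - b)\<^sup>2 \<le> 0"
    by (simp add: power2_eq_square algebra_simps)
  then show ?thesis by simp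
qed

theorem theorem2p1:
  fixes X Y Z \<psi> w :: "real ^ 'n::{finite,linorder}"
    and \<sigma> S :: real
    and p q :: ennreal
    and r :: nat
  assumes "\<sigma> > 0"
    and "X = Y + \<sigma> *\<^sub>R Z"
    and "1 \<le> p" and "1 \<le> q" and "1 / p + 1 / q = 1"
    and "\<forall>k. 0 \<le> w $ k"
    and "r \<in> {1, 2}"
    and "\<psi> * w \<noteq> 0"
    and "is_arg_min (weighted_loss r w \<psi> X) (\<lambda>s. True) S"
  shows "\<bar>S - \<sigma>\<bar>
    \<le> 2 ^ (2 - r) * (lp_norm q (w * abs_pow \<psi> (r - 1)) / (w \<bullet> abs_pow \<psi> r)) * lp_norm p Y
      + 2 ^ (2 - r) * \<sigma> *
        ((w \<bullet> abs_pow (rearr Z - \<psi>) r) / (w \<bullet> abs_pow \<psi> r)) powr (1 / real r)"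
proof -
  define D where "D = rearr X - \<sigma> *\<^sub>R rearr Z"
  define E where "E = rearr Z - \<psi>"
  define W where "W = w \<bullet> abs_pow \<psi> r"
  have w: "0 \<le> w $ k" for k
    using assms(6) by blast
  have W: "W = (\<Sum>k\<in>UNIV. w $ k * \<bar>\<psi> $ k\<bar> ^ r)"
    by (simp add: W_def inner_vec_def abs_pow_def)
  \<comment> \<open>The residual at the true scale splits into the effect \<open>D\<close> of the
    signal and the scaled proxy error \<open>E\<close>.\<close>
  have resid: "rearr X $ k - \<sigma> * \<psi> $ k = D $ k + \<sigma> * E $ k" for k
    by (simp add: D_def E_def algebra_simps)
  have "W \<noteq> 0"
  proof
    assume "W = 0"
    then have "\<forall>k\<in>UNIV. w $ k * \<bar>\<psi> $ k\<bar> ^ r = 0"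
      unfolding W using w by (subst (asm) sum_nonneg_eq_0_iff) auto
    then have "\<psi> * w = 0"
      by (auto simp: vec_eq_iff)
    with assms(8) show False ..
  qed
  moreover have "0 \<le> W"
    unfolding W using w by (intro sum_nonneg) auto
  ultimately have "0 < W" by simp
  \<comment> \<open>Since \<open>\<sigma> > 0\<close>, scaling commutes with sorting, so
    \<open>D\<close> is a difference of sorted vectors whose unsorted difference is
    \<open>Y\<close>.\<close>
  have "lp_norm p D = lp_norm p (rearr X - rearr (\<sigma> *\<^sub>R Z))"
    using assms(1) by (simp add: D_def rearr_scaleR)
  also have "\<dots> \<le> lp_norm p Y"
    using lp_norm_rearr_diff_le[OF assms(3), of X "\<sigma> *\<^sub>R Z"] by (simp add: assms(2))
  finally have D: "lp_norm p D \<le> lp_norm p Y" .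
  define N where "N = lp_norm q (w * abs_pow \<psi> (r - 1))"
  \<comment> \<open>One estimate serves both values of \<open>r\<close>: for \<open>r = 1\<close>
    the weight is \<open>w\<close> itself, also where \<open>\<psi>\<close> vanishes, because
    \<open>0 ^ 0 = 1\<close>.\<close>
  have "(\<Sum>k\<in>UNIV. w $ k * \<bar>\<psi> $ k\<bar> ^ (r - 1) * \<bar>D $ k\<bar>)
      = (\<Sum>k\<in>UNIV. \<bar>(w * abs_pow \<psi> (r - 1)) $ k\<bar> * \<bar>D $ k\<bar>)"
    using w by (simp add: abs_pow_def abs_mult)
  also have "\<dots> \<le> N * lp_norm p D"
    unfolding N_def by (rule sum_abs_mult_le_lp_norm[OF assms(3-5)])
  also have "\<dots> \<le> N * lp_norm p Y"
    unfolding N_def by (intro mult_left_mono D lp_norm_nonneg)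
  finally have Holder: "(\<Sum>k\<in>UNIV. w $ k * \<bar>\<psi> $ k\<bar> ^ (r - 1) * \<bar>D $ k\<bar>) \<le> N * lp_norm p Y" .
  define V where "V = w \<bullet> abs_pow E r"
  have V: "V = (\<Sum>k\<in>UNIV. w $ k * \<bar>E $ k\<bar> ^ r)"
    by (simp add: V_def inner_vec_def abs_pow_def)
  then have "0 \<le> V"
    using w by (auto intro!: sum_nonneg)
  have min: "weighted_loss r w \<psi> X S \<le> weighted_loss r w \<psi> X t" for t
    using assms(9) by (simp add: is_arg_min_linorder)
  have "\<bar>S - \<sigma>\<bar> \<le> 2 ^ (2 - r) * (N / W) * lp_norm p Y + 2 ^ (2 - r) * \<sigma> * (V / W) powr (1 / real r)"
    using assms(7)
  proof (rule insertE)
    assume r: "r = 1"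
    have "\<bar>S - \<sigma>\<bar> * W = (\<Sum>k\<in>UNIV. w $ k * \<bar>(rearr X $ k - \<sigma> * \<psi> $ k) - (rearr X $ k - S * \<psi> $ k)\<bar>)"
      unfolding W r sum_distrib_left
      by (intro sum.cong refl) (simp add: abs_mult flip: left_diff_distrib)
    also have "\<dots> \<le> (\<Sum>k\<in>UNIV. w $ k * (\<bar>rearr X $ k - \<sigma> * \<psi> $ k\<bar> + \<bar>rearr X $ k - S * \<psi> $ k\<bar>))"
      by (intro sum_mono mult_left_mono w) linarith
    also have "\<dots> = weighted_loss r w \<psi> X \<sigma> + weighted_loss r w \<psi> X S"
      by (simp add: r weighted_loss_def distrib_left sum.distrib)
    \<comment> \<open>Minimality of \<open>S\<close> yields the factor
      \<open>2 ^ (2 - r) = 2\<close>.\<close>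
    also have "\<dots> \<le> 2 * weighted_loss r w \<psi> X \<sigma>"
      using min[of \<sigma>] by simp
    also have "weighted_loss r w \<psi> X \<sigma> = (\<Sum>k\<in>UNIV. w $ k * \<bar>D $ k + \<sigma> * E $ k\<bar>)"
      by (simp add: r weighted_loss_def resid)
    also have "\<dots> \<le> (\<Sum>k\<in>UNIV. w $ k * (\<bar>D $ k\<bar> + \<sigma> * \<bar>E $ k\<bar>))"
    proof (intro sum_mono mult_left_mono w)
      show "\<bar>D $ k + \<sigma> * E $ k\<bar> \<le> \<bar>D $ k\<bar> + \<sigma> * \<bar>E $ k\<bar>" for k
        using abs_triangle_ineq[of "D $ k" "\<sigma> * E $ k"] assms(1) by (simp add: abs_mult)
    qed
    also have "\<dots> = (\<Sum>k\<in>UNIV. w $ k * \<bar>\<psi> $ k\<bar> ^ (r - 1) * \<bar>D $ k\<bar>) + \<sigma> * V"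
      by (simp add: r V distrib_left sum.distrib sum_distrib_left mult_ac)
    also have "\<dots> \<le> N * lp_norm p Y + \<sigma> * V"
      using Holder by simp
    finally have "\<bar>S - \<sigma>\<bar> * W \<le> 2 * (N * lp_norm p Y + \<sigma> * V)" by simp
    then have "\<bar>S - \<sigma>\<bar> \<le> 2 * (N * lp_norm p Y + \<sigma> * V) / W"
      using \<open>0 < W\<close> by (simp add: pos_le_divide_eq)
    then show ?thesis
      using \<open>0 < W\<close> \<open>0 \<le> V\<close> by (simp add: r add_divide_distrib distrib_left)
  next
    assume "r \<in> {2}"
    then have r: "r = 2" by simp
    define A where "A = (\<Sum>k\<in>UNIV. w $ k * (rearr X $ k)\<^sup>2)"
    define B where "B = (\<Sum>k\<in>UNIV. w $ k * \<psi> $ k * rearr X $ k)"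
    have loss: "weighted_loss r w \<psi> X t = A - 2 * B * t + W * t\<^sup>2" for t
      unfolding weighted_loss_def A_def B_def W r
      by (simp add: power2_eq_square sum_distrib_left sum_distrib_right algebra_simps
          flip: sum.distrib sum_subtractf)
    \<comment> \<open>This is the normal equation. Subtracting \<open>W * \<sigma>\<close> then
      expresses the error exactly as a weighted pairing of \<open>\<psi>\<close> with the residual
      at \<open>\<sigma>\<close>, so no factor 2 arises.\<close>
    have "W * S = B"
      using min \<open>0 < W\<close> unfolding loss by (rule quadratic_arg_min_eq[rotated])
    then have "W * (S - \<sigma>) = (\<Sum>k\<in>UNIV. w $ k * \<psi> $ k * (rearr X $ k - \<sigma> * \<psi> $ k))"
      by (simp add: B_def W r power2_eq_square sum_distrib_left algebra_simps sum_subtractf)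
    also have "\<dots> = (\<Sum>k\<in>UNIV. w $ k * \<psi> $ k * D $ k) + \<sigma> * (\<Sum>k\<in>UNIV. w $ k * \<psi> $ k * E $ k)"
      by (simp add: resid sum_distrib_left algebra_simps sum.distrib)
    also have "\<bar>\<dots>\<bar> \<le> \<bar>\<Sum>k\<in>UNIV. w $ k * \<psi> $ k * D $ k\<bar>
        + \<sigma> * \<bar>\<Sum>k\<in>UNIV. w $ k * \<psi> $ k * E $ k\<bar>"
      by (rule order_trans[OF abs_triangle_ineq]) (use assms(1) in \<open>simp add: abs_mult\<close>)
    finally have "\<bar>S - \<sigma>\<bar> * W \<le> \<bar>\<Sum>k\<in>UNIV. w $ k * \<psi> $ k * D $ k\<bar>
        + \<sigma> * \<bar>\<Sum>k\<in>UNIV. w $ k * \<psi> $ k * E $ k\<bar>"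
      using \<open>0 < W\<close> by (simp add: abs_mult mult.commute)
    moreover have "\<bar>\<Sum>k\<in>UNIV. w $ k * \<psi> $ k * D $ k\<bar> \<le> N * lp_norm p Y"
    proof (rule order_trans[OF sum_abs])
      show "(\<Sum>k\<in>UNIV. \<bar>w $ k * \<psi> $ k * D $ k\<bar>) \<le> N * lp_norm p Y"
        using Holder w by (simp add: r abs_mult)
    qed
    moreover have "\<bar>\<Sum>k\<in>UNIV. w $ k * \<psi> $ k * E $ k\<bar> \<le> sqrt (V * W)"
    proof (rule real_le_rsqrt)
      \<comment> \<open>Splitting each weight into two square roots makes the Cauchy-Schwarz factors
        equal to \<open>V\<close> and \<open>W\<close>.\<close>
      have "\<bar>\<Sum>k\<in>UNIV. w $ k * \<psi> $ k * E $ k\<bar>\<^sup>2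
          = (\<Sum>k\<in>UNIV. (sqrt (w $ k) * E $ k) * (sqrt (w $ k) * \<psi> $ k))\<^sup>2"
        using w by (simp add: mult_ac)
      also have "\<dots> \<le> (\<Sum>k\<in>UNIV. (sqrt (w $ k) * E $ k)\<^sup>2) * (\<Sum>k\<in>UNIV. (sqrt (w $ k) * \<psi> $ k)\<^sup>2)"
        by (rule Cauchy_Schwarz_ineq_sum)
      also have "\<dots> = V * W"
        using w by (simp add: V W r power_mult_distrib)
      finally show "\<bar>\<Sum>k\<in>UNIV. w $ k * \<psi> $ k * E $ k\<bar>\<^sup>2 \<le> V * W" .
    qed
    ultimately have "\<bar>S - \<sigma>\<bar> * W \<le> N * lp_norm p Y + \<sigma> * sqrt (V * W)"
      using assms(1) by (smt (verit) mult_left_mono)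
    then have "\<bar>S - \<sigma>\<bar> \<le> (N * lp_norm p Y + \<sigma> * sqrt (V * W)) / W"
      using \<open>0 < W\<close> by (simp add: pos_le_divide_eq)
    moreover have "sqrt (V * W) / W = (V / W) powr (1 / 2)"
    proof -
      have "sqrt (V * W) / W = sqrt V * (sqrt W / W)"
        by (simp add: real_sqrt_mult)
      also have "sqrt W / W = 1 / sqrt W"
        using \<open>0 < W\<close> by (simp add: field_simps)
      finally show ?thesis
        using \<open>0 < W\<close> \<open>0 \<le> V\<close> by (simp add: powr_half_sqrt real_sqrt_divide)
    qed
    ultimately show ?thesis
      by (simp add: r add_divide_distrib flip: times_divide_eq_right)
  qed
  then show ?thesis
    by (simp only: N_def W_def V_def E_def)
qed

end
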